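(* Let $M \geq 2$ and $N \geq 1$ be integers, let $H=(V(H),E(H))$ be a simple connected undirected graph with $|V(H)|=N$ and $|E(H)|=M-1$, and let $P^H_k$ be the distribution function of the random $K$-out-of-$(M-1)$ system corresponding to $H$. Take two distinct non-adjacent vertices $u,v\in V(H)$, and let $G=(V(G),E(G))$ be the graph with $V(G)=V(H)$ and $E(G)=E(H)\cup\{uv\}$. Let $P^G_k$ be the distribution function of the random $K$-out-of-$M$ system corresponding to $G$. Then for every integer $k\ge 1$, $$P^G_k=\begin{cases}\displaystyle \left[P^H_k\binom{M-1}{k}+P^H_{k-1}\binom{M-1}{k-1}-n^H_k\right]\Big/\binom{M}{k} & \text{if } 1\le k\le M-1 \text{ and } P^G_{k-1}<1,\\[8pt] 1 & \text{otherwise,}\end{cases}$$ where $n^H_k$ is the number of $H$-disconnected sets $F$ of size $k$ such that $F$ includes only one $uv$-cut set $F'$ of $H$ and $F\setminus F'$ is not an $H$-disconnected set, and where $P^H_0\binom{M-1}{0}=0$.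
   Context: For a simple connected undirected graph $G=(V(G),E(G))$, an edge set $F\subset E(G)$ is called a $G$-disconnected set if the graph $G-F$ (same vertex set, edges of $F$ deleted) is not connected; its size is $|F|$. For distinct vertices $u,v\in V(G)$, an edge set $F\subset E(G)$ is a $uv$-disconnected set of $G$ if there is no path from $u$ to $v$ in $G-F$; it is a $uv$-cut set of $G$ if it is a $uv$-disconnected set and no proper subset of it is a $uv$-disconnected set. For a simple connected undirected graph $G$ with $|E(G)|=m\ge 1$, each edge is regarded as a unit of a random $K$-out-of-$m$ system, where $K$ is a random variable with values in $\{1,\dots,m\}$. The distribution function $P^G_k=P(K\le k)$, $1\le k\le m$, of the system corresponding to $G$ is the probability that $G$ becomes disconnected when $k$ of its $m$ edges, chosen uniformly at random, are deleted; that is, $$P^G_k=\frac{\#\{F\subset E(G): |F|=k,\ F \text{ is a } G\text{-disconnected set}\}}{\binom{m}{k}}.$$ Being a distribution function of a variable with values in $\{1,\dots,m\}$, it is extended by $P^G_0=0$ and $P^G_k=1$ for $k>m$. *)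

theory Defs
  imports Complex_Main
begin

record 'a sgraph =
  verts :: "'a set"
  edges :: "'a set set"

definition simple_graph :: "'a sgraph \<Rightarrow> bool" where
  "simple_graph G \<longleftrightarrow> finite (verts G) \<and> (\<forall>e\<in>edges G. e \<subseteq> verts G \<and> card e = 2)"

definition path_between :: "'a sgraph \<Rightarrow> 'a \<Rightarrow> 'a \<Rightarrow> 'a list \<Rightarrow> bool" where
  "path_between G u v p \<longleftrightarrow>
     p \<noteq> [] \<and> hd p = u \<and> last p = v \<and> distinct p \<and> set p \<subseteq> verts G \<and>
     successively (\<lambda>x y. {x, y} \<in> edges G) p"

definition connected_graph :: "'a sgraph \<Rightarrow> bool" where
  "connected_graph G \<longleftrightarrow>
     verts G \<noteq> {} \<and> (\<forall>u\<in>verts G. \<forall>v\<in>verts G. \<exists>p. path_between G u v p)"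

definition delete_edges :: "'a sgraph \<Rightarrow> 'a set set \<Rightarrow> 'a sgraph" where
  "delete_edges G F = G\<lparr>edges := edges G - F\<rparr>"

definition disconnected_set :: "'a sgraph \<Rightarrow> 'a set set \<Rightarrow> bool" where
  "disconnected_set G F \<longleftrightarrow> F \<subseteq> edges G \<and> \<not> connected_graph (delete_edges G F)"

definition uv_disconnected_set :: "'a sgraph \<Rightarrow> 'a \<Rightarrow> 'a \<Rightarrow> 'a set set \<Rightarrow> bool" where
  "uv_disconnected_set G u v F \<longleftrightarrow>
     F \<subseteq> edges G \<and> \<not> (\<exists>p. path_between (delete_edges G F) u v p)"

definition uv_cut_set :: "'a sgraph \<Rightarrow> 'a \<Rightarrow> 'a \<Rightarrow> 'a set set \<Rightarrow> bool" where
  "uv_cut_set G u v F \<longleftrightarrow>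
     uv_disconnected_set G u v F \<and> (\<forall>F'. F' \<subset> F \<longrightarrow> \<not> uv_disconnected_set G u v F')"

text \<open>
  Distribution function of the random \<open>K\<close>-out-of-\<open>m\<close> system of a graph with \<open>m\<close> edges:
  the probability that deleting \<open>k\<close> edges chosen uniformly at random disconnects the graph
  for \<open>1 \<le> k \<le> m\<close>, extended by \<open>0\<close> at \<open>k = 0\<close> and by \<open>1\<close> for \<open>k > m\<close>.
\<close>

definition system_cdf :: "'a sgraph \<Rightarrow> nat \<Rightarrow> real" where
  "system_cdf G k =
     (if k = 0 then 0
      else if k \<le> card (edges G)
        then real (card {F. F \<subseteq> edges G \<and> card F = k \<and> disconnected_set G F})
               / real (card (edges G) choose k)
      else 1)"

definition single_cut_count :: "'a sgraph \<Rightarrow> 'a \<Rightarrow> 'a \<Rightarrow> nat \<Rightarrow> nat" where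
  "single_cut_count H u v k =
     card {F. disconnected_set H F \<and> card F = k \<and>
              (\<exists>F'. F' \<subseteq> F \<and> uv_cut_set H u v F' \<and>
                    (\<forall>F''. F'' \<subseteq> F \<and> uv_cut_set H u v F'' \<longrightarrow> F'' = F') \<and>
                    \<not> disconnected_set H (F - F'))}"

end

theory Submission
  imports Defs
begin

text \<open>
  A \<open>G\<close>-disconnected set containing \<open>uv\<close> is an \<open>H\<close>-disconnected set together with \<open>uv\<close>; one
  avoiding \<open>uv\<close> is an \<open>H\<close>-disconnected set \<open>F\<close> such that adding \<open>uv\<close> to \<open>H - F\<close> does not
  restore connectedness. The sets \<open>F\<close> for which it does are those where \<open>H - F\<close> has exactly
  two components, one containing \<open>u\<close> and the other \<open>v\<close>. In that case the edges of \<open>H\<close> between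
  the two components form the only \<open>uv\<close>-cut set inside \<open>F\<close>. Conversely, a unique \<open>uv\<close>-cut set
  \<open>F'\<close> inside \<open>F\<close> lies in the edge boundaries of both the component of \<open>u\<close> and the component
  of \<open>v\<close>, so restoring \<open>F'\<close> could not connect any third component of \<open>H - F\<close>.
\<close>

section \<open>Reachability in an edge set, and edge boundaries\<close>

definition joined :: "'a set set \<Rightarrow> 'a \<Rightarrow> 'a \<Rightarrow> bool" where
  "joined E x y \<longleftrightarrow> (x, y) \<in> {(x, y). {x, y} \<in> E}\<^sup>*"

definition edge_boundary :: "'a set set \<Rightarrow> 'a set \<Rightarrow> 'a set set" where
  "edge_boundary E A = {e \<in> E. \<exists>x\<in>A. \<exists>y. y \<notin> A \<and> e = {x, y}}"

lemma joined_refl [simp]: "joined E x x"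
  by (simp add: joined_def)

lemma joined_edge: "{x, y} \<in> E \<Longrightarrow> joined E x y"
  by (auto simp: joined_def)

lemma joined_trans [trans]: "joined E x y \<Longrightarrow> joined E y z \<Longrightarrow> joined E x z"
  by (auto simp: joined_def)

lemma joined_sym: "joined E x y \<Longrightarrow> joined E y x"
proof -
  have "sym {(x, y). {x, y} \<in> E}"
    by (auto simp: sym_def insert_commute)
  then have "sym ({(x, y). {x, y} \<in> E}\<^sup>*)"
    by (rule sym_rtrancl)
  then show "joined E x y \<Longrightarrow> joined E y x"
    by (auto simp: joined_def dest: symD)
qed

lemma joined_mono: "joined E x y \<Longrightarrow> E \<subseteq> E' \<Longrightarrow> joined E' x y"
  unfolding joined_def by (erule rev_subsetD, rule rtrancl_mono) auto

lemma joined_induct [consumes 1, case_names refl step]: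
  assumes "joined E x y" "P x"
    and "\<And>y z. joined E x y \<Longrightarrow> {y, z} \<in> E \<Longrightarrow> P y \<Longrightarrow> P z"
  shows "P y"
  using assms(1) unfolding joined_def
proof (induction rule: rtrancl_induct)
  case base
  show ?case by (rule assms(2))
next
  case (step y z)
  then show ?case using assms(3)[of y z] by (auto simp: joined_def)
qed

text \<open>Without a boundary edge every step of a walk that starts in \<open>A\<close> stays in
  \<open>A\<close>. This is the source of all crossing edges below.\<close>

lemma joined_crosses_boundary:
  assumes "joined E x y" "x \<in> A" "y \<notin> A"
  shows "edge_boundary E A \<noteq> {}"
proof
  assume "edge_boundary E A = {}"
  with assms(1,2) have "y \<in> A"
    by (induction rule: joined_induct) (auto simp: edge_boundary_def)
  with assms(3) show False by simp
qed

lemma not_joined_diff_boundary: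
  assumes "x \<in> A" "y \<notin> A"
  shows "\<not> joined (E - edge_boundary E A) x y"
proof
  assume "joined (E - edge_boundary E A) x y"
  from joined_crosses_boundary[OF this assms] show False
    by (auto simp: edge_boundary_def)
qed

text \<open>An edge that survives the deletion of \<open>F\<close> and starts in a component also
  ends in it, so only deleted edges can leave the component.\<close>

lemma edge_boundary_component: "edge_boundary E {y. joined (E - F) x y} \<subseteq> F"
proof
  fix d assume "d \<in> edge_boundary E {y. joined (E - F) x y}"
  then obtain a b where d: "d \<in> E" "d = {a, b}" "joined (E - F) x a" "\<not> joined (E - F) x b"
    by (auto simp: edge_boundary_def)
  then show "d \<in> F"
    using joined_trans[OF d(3) joined_edge, of b] by blast
qed

text \<open>Repeated traversals of the new edge collapse: going over and back returns to an end that
  was already reached inside \<open>S\<close>. Hence at most one traversal, in one of the two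
  directions, has to be recorded.\<close>

lemma joined_insert_cases:
  assumes "joined (insert {u, v} S) x y"
  shows "joined S x y \<or> joined S x u \<and> joined S v y \<or> joined S x v \<and> joined S u y"
  using assms
proof (induction rule: joined_induct)
  case refl
  show ?case by simp
next
  case (step y z)
  from step.hyps(2) consider "{y, z} \<in> S" | "y = u" "z = v" | "y = v" "z = u"
    by (auto simp: doubleton_eq_iff)
  then show ?case
  proof cases
    case 1
    then show ?thesis using step.IH joined_trans[OF _ joined_edge[OF 1]] by blast
  next
    case 2
    then show ?thesis using step.IH by (auto intro: joined_refl)
  next
    case 3
    then show ?thesis using step.IH by (auto intro: joined_refl)
  qed
qed

section \<open>Paths and disconnected sets expressed by reachability\<close>

lemma path_between_imp_joined:
  assumes "path_between G x y p"
  shows "joined (edges G) x y"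
proof -
  have "joined (edges G) (hd p) (last p)"
    if "p \<noteq> []" "successively (\<lambda>x y. {x, y} \<in> edges G) p" for p
    using that
  proof (induction p)
    case (Cons a p)
    then show ?case
      by (cases p) (auto intro: joined_trans[OF joined_edge])
  qed simp
  with assms show ?thesis by (auto simp: path_between_def)
qed

lemma joined_imp_path_between:
  assumes "\<Union> (edges G) \<subseteq> verts G" "x \<in> verts G" "joined (edges G) x y"
  shows "\<exists>p. path_between G x y p"
  \<comment> \<open>The induction runs backwards from \<open>y\<close>, so that the path grows at
    its head, where \<open>Cons\<close> acts.\<close>
  using joined_sym[OF assms(3)]
proof (induction rule: joined_induct)
  case refl
  have "path_between G y y [y]"
    using assms joined_induct[OF assms(3), of "\<lambda>y. y \<in> verts G"]
    by (auto simp: path_between_def)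
  then show ?case by blast
next
  case (step a b)
  then obtain p where p: "path_between G a y p" by blast
  show ?case
  proof (cases "b \<in> set p")
    \<comment> \<open>The new vertex is already on the path; dropping everything before it keeps the
      vertices distinct.\<close>
    case True
    then obtain q r where "p = q @ b # r" by (auto simp: in_set_conv_decomp)
    with p have "path_between G b y (b # r)"
      by (auto simp: path_between_def successively_append_iff)
    then show ?thesis by blast
  next
    case False
    moreover have "b \<in> verts G" using assms(1) step.hyps(2) by auto
    ultimately have "path_between G b y (b # p)"
      using p step.hyps(2)
      by (cases p) (auto simp: path_between_def insert_commute)
    then show ?thesis by blast
  qed
qed

lemma simple_graph_edges_subset: "simple_graph G \<Longrightarrow> \<Union> (edges G) \<subseteq> verts G"
  by (auto simp: simple_graph_def)

lemma simple_graph_finite_edges: "simple_graph G \<Longrightarrow> finite (edges G)"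
  by (rule finite_subset[of _ "Pow (verts G)"]) (auto simp: simple_graph_def)

text \<open>Replaces paths by \<open>joined\<close>, for which deleting edges is plain set
  difference. Since \<open>joined\<close> is reflexive even at points outside the graph,
  \<open>u\<close> must be a vertex.\<close>

lemma uv_disconnected_set_iff:
  assumes "simple_graph G" "u \<in> verts G"
  shows "uv_disconnected_set G u v F \<longleftrightarrow> F \<subseteq> edges G \<and> \<not> joined (edges G - F) u v"
proof -
  have "(\<exists>p. path_between (delete_edges G F) u v p) \<longleftrightarrow> joined (edges G - F) u v"
    using path_between_imp_joined[of "delete_edges G F" u v]
      joined_imp_path_between[of "delete_edges G F" u v]
      simple_graph_edges_subset[OF assms(1)] assms(2)
    by (auto simp: delete_edges_def)
  then show ?thesis by (simp add: uv_disconnected_set_def)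
qed

text \<open>Reachability is an equivalence, so connectedness can be tested from the single base
  vertex \<open>u\<close>, which also witnesses that the vertex set is nonempty.\<close>

lemma disconnected_set_iff:
  assumes "simple_graph G" "u \<in> verts G"
  shows "disconnected_set G F \<longleftrightarrow>
    F \<subseteq> edges G \<and> (\<exists>x\<in>verts G. \<not> joined (edges G - F) u x)"
proof -
  have path: "(\<exists>p. path_between (delete_edges G F) x y p) \<longleftrightarrow> joined (edges G - F) x y"
    if "x \<in> verts G" for x y
    using path_between_imp_joined[of "delete_edges G F" x y]
      joined_imp_path_between[of "delete_edges G F" x y]
      simple_graph_edges_subset[OF assms(1)] that
    by (auto simp: delete_edges_def)
  have "connected_graph (delete_edges G F) \<longleftrightarrow>
      (\<forall>x\<in>verts G. \<forall>y\<in>verts G. joined (edges G - F) x y)"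
    using assms(2) path by (auto simp: connected_graph_def delete_edges_def)
  also have "\<dots> \<longleftrightarrow> (\<forall>x\<in>verts G. joined (edges G - F) u x)"
    using assms(2) by (meson joined_sym joined_trans)
  finally show ?thesis by (auto simp: disconnected_set_def)
qed

lemma disconnected_set_mono:
  assumes "simple_graph G" "u \<in> verts G"
    and "disconnected_set G F" "F \<subseteq> F'" "F' \<subseteq> edges G"
  shows "disconnected_set G F'"
  using assms(3-5) unfolding disconnected_set_iff[OF assms(1,2)]
  by (meson Diff_mono joined_mono order_refl)

text \<open>Passing to proper subsets that still separate must stop, because \<open>F\<close> is
  finite, and it stops at a minimal one.\<close>

lemma uv_disconnected_set_contains_cut:
  assumes "finite F" "uv_disconnected_set G u v F"
  shows "\<exists>F'\<subseteq>F. uv_cut_set G u v F'"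
  using assms
proof (induction F rule: finite_psubset_induct)
  case (psubset F)
  show ?case
  proof (cases "uv_cut_set G u v F")
    case False
    then obtain F' where "F' \<subset> F" "uv_disconnected_set G u v F'"
      using psubset.prems by (auto simp: uv_cut_set_def)
    with psubset.IH[of F'] show ?thesis by blast
  qed blast
qed

section \<open>Edge sets of \<open>H\<close> whose deletion is repaired by the edge
  \<open>uv\<close>\<close>

locale missing_edge =
  fixes H :: "'a sgraph" and u v :: 'a
  assumes simple: "simple_graph H" and connected: "connected_graph H"
    and u: "u \<in> verts H" and v: "v \<in> verts H"
begin

lemma joined_all: "x \<in> verts H \<Longrightarrow> joined (edges H) u x"
  using connected u path_between_imp_joined by (metis connected_graph_def)

text \<open>The hypothesis is symmetric in \<open>u\<close> and \<open>v\<close> so that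
  \<open>A\<close> may be the component of either of them.\<close>

lemma edge_boundary_uv_disconnected:
  assumes "u \<in> A \<longleftrightarrow> v \<notin> A"
  shows "uv_disconnected_set H u v (edge_boundary (edges H) A)"
proof -
  have "\<not> joined (edges H - edge_boundary (edges H) A) u v"
    using assms not_joined_diff_boundary joined_sym by metis
  then show ?thesis
    unfolding uv_disconnected_set_iff[OF simple u] by (auto simp: edge_boundary_def)
qed

text \<open>Every edge leaving the component of \<open>u\<close> ends in that of \<open>v\<close>.
  If \<open>F'\<close> missed one, this edge would join \<open>u\<close> to \<open>v\<close>. So
  \<open>F'\<close> contains the boundary, which already separates, and minimality gives
  equality.\<close>

lemma two_components_unique_cut:
  assumes F: "F \<subseteq> edges H" and nj: "\<not> joined (edges H - F) u v"
    and two: "\<And>x. x \<in> verts H \<Longrightarrow> joined (edges H - F) u x \<or> joined (edges H - F) v x"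
    and cut: "uv_cut_set H u v F'" "F' \<subseteq> F"
  shows "F' = edge_boundary (edges H) {x. joined (edges H - F) u x}"
proof -
  define B where "B = edge_boundary (edges H) {x. joined (edges H - F) u x}"
  have njF': "\<not> joined (edges H - F') u v"
    using cut(1) uv_disconnected_set_iff[OF simple u] by (auto simp: uv_cut_set_def)
  have "B \<subseteq> F'"
  proof
    fix d assume "d \<in> B"
    then obtain a b where d: "d \<in> edges H" "d = {a, b}"
      "joined (edges H - F) u a" "\<not> joined (edges H - F) u b"
      by (auto simp: B_def edge_boundary_def)
    then have "b \<in> verts H" using simple_graph_edges_subset[OF simple] by auto
    with two d(4) have "joined (edges H - F) v b" by blast
    then have "joined (edges H - F') b v" "joined (edges H - F') u a"
      using d(3) cut(2) by (meson Diff_mono joined_mono joined_sym order_refl)+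
    then show "d \<in> F'"
      using njF' d(1,2) by (meson DiffI joined_edge joined_trans)
  qed
  moreover have "uv_disconnected_set H u v B"
    unfolding B_def using nj by (intro edge_boundary_uv_disconnected) auto
  ultimately show ?thesis
    using cut(1) by (auto simp: uv_cut_set_def B_def)
qed

lemma reconnecting_imp_single_cut:
  assumes F: "F \<subseteq> edges H" and nj: "\<not> joined (edges H - F) u v"
    and two: "\<And>x. x \<in> verts H \<Longrightarrow> joined (edges H - F) u x \<or> joined (edges H - F) v x"
  shows "\<exists>F'. F' \<subseteq> F \<and> uv_cut_set H u v F' \<and>
    (\<forall>F''. F'' \<subseteq> F \<and> uv_cut_set H u v F'' \<longrightarrow> F'' = F') \<and> \<not> disconnected_set H (F - F')"
proof -
  define B where "B = edge_boundary (edges H) {x. joined (edges H - F) u x}"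
  have uniq: "F' = B" if "F' \<subseteq> F" "uv_cut_set H u v F'" for F'
    using two_components_unique_cut[OF F nj two that(2,1)] by (simp add: B_def)
  have "finite F" using F simple_graph_finite_edges[OF simple] finite_subset by blast
  moreover have "uv_disconnected_set H u v F"
    using F nj uv_disconnected_set_iff[OF simple u] by blast
  \<comment> \<open>\<open>F\<close> contains some cut set, and by \<open>uniq\<close> this can only
    be \<open>B\<close>.\<close>
  ultimately have B: "B \<subseteq> F" "uv_cut_set H u v B"
    using uv_disconnected_set_contains_cut uniq by metis+
  have "B \<noteq> {}"
    unfolding B_def using nj joined_all[OF v] by (intro joined_crosses_boundary) auto
  then obtain a b where ab: "{a, b} \<in> B" "{a, b} \<in> edges H"
    "joined (edges H - F) u a" "\<not> joined (edges H - F) u b"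
    by (auto simp: B_def edge_boundary_def)
  then have "b \<in> verts H" using simple_graph_edges_subset[OF simple] by auto
  with two ab(4) have "joined (edges H - F) v b" by blast
  \<comment> \<open>\<open>S\<close> is what remains of \<open>H\<close> when \<open>B\<close> is
    restored. A single restored edge \<open>{a, b}\<close> already links the two components.\<close>
  define S where "S = edges H - (F - B)"
  have sub: "edges H - F \<subseteq> S" by (auto simp: S_def)
  have "joined S u a" "joined S b v"
    using ab(3) \<open>joined (edges H - F) v b\<close> sub by (meson joined_mono joined_sym)+
  moreover have "joined S a b" using ab(1,2) by (intro joined_edge) (auto simp: S_def)
  ultimately have "joined S u v" by (meson joined_trans)
  then have "joined S u x" if "x \<in> verts H" for x
    using two[OF that] sub by (meson joined_mono joined_trans)
  then have "\<not> disconnected_set H (F - B)"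
    unfolding disconnected_set_iff[OF simple u] by (simp add: S_def)
  with B uniq show ?thesis by blast
qed

lemma single_cut_imp_two_components:
  assumes F: "F \<subseteq> edges H" and cut: "F' \<subseteq> F" "uv_cut_set H u v F'"
    and uniq: "\<And>F''. F'' \<subseteq> F \<Longrightarrow> uv_cut_set H u v F'' \<Longrightarrow> F'' = F'"
    and conn: "\<not> disconnected_set H (F - F')" and x: "x \<in> verts H"
  shows "joined (edges H - F) u x \<or> joined (edges H - F) v x"
proof (rule ccontr)
  assume nx: "\<not> ?thesis"
  have "\<not> joined (edges H - F') u v"
    using cut(2) uv_disconnected_set_iff[OF simple u] by (auto simp: uv_cut_set_def)
  then have nj: "\<not> joined (edges H - F) u v"
    using cut(1) by (meson Diff_mono joined_mono order_refl)
  \<comment> \<open>The boundary of either component lies in \<open>F\<close> and separates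
    \<open>u\<close> from \<open>v\<close>, so it contains a cut set; by uniqueness that cut set is
    \<open>F'\<close>.\<close>
  have sub: "F' \<subseteq> edge_boundary (edges H) {y. joined (edges H - F) w y}"
    if "w = u \<or> w = v" for w
  proof -
    define B where "B = edge_boundary (edges H) {y. joined (edges H - F) w y}"
    have B: "B \<subseteq> F" unfolding B_def by (rule edge_boundary_component)
    then have "finite B"
      using finite_subset[OF F simple_graph_finite_edges[OF simple]] by (rule finite_subset)
    moreover have "uv_disconnected_set H u v B"
      unfolding B_def using nj that joined_sym[of _ v u]
      by (intro edge_boundary_uv_disconnected) auto
    ultimately obtain F'' where "F'' \<subseteq> B" "uv_cut_set H u v F''"
      by (meson uv_disconnected_set_contains_cut)
    with uniq[of F''] B show ?thesis by (simp add: B_def)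
  qed
  let ?C = "{y. joined (edges H - F) u y \<or> joined (edges H - F) v y}"
  have "F - F' \<subseteq> edges H" using F by blast
  \<comment> \<open>Restoring \<open>F'\<close> reaches the third component of \<open>x\<close>, so
    some edge leaves the union \<open>?C\<close> of the other two, and it must be a restored
    one.\<close>
  then have "joined (edges H - (F - F')) u x"
    using conn x unfolding disconnected_set_iff[OF simple u] by blast
  moreover have "u \<in> ?C" by simp
  moreover have "x \<notin> ?C" using nx by simp
  ultimately have "edge_boundary (edges H - (F - F')) ?C \<noteq> {}"
    by (rule joined_crosses_boundary)
  then obtain a b where ab: "{a, b} \<in> edges H" "{a, b} \<notin> F - F'"
    "a \<in> ?C" "b \<notin> ?C"
    by (auto simp: edge_boundary_def)
  then have "{a, b} \<notin> edges H - F"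
    using joined_trans[OF _ joined_edge[of a b]] by blast
  with ab have "{a, b} \<in> F'" by blast
  then have "{a, b} \<in> edge_boundary (edges H) {y. joined (edges H - F) u y}"
    "{a, b} \<in> edge_boundary (edges H) {y. joined (edges H - F) v y}"
    using sub by blast+
  \<comment> \<open>The edge is in both boundaries while \<open>b\<close> is in neither component,
    so \<open>a\<close> would lie in both.\<close>
  then have "joined (edges H - F) u a" "joined (edges H - F) v a"
    using ab(4) by (auto simp: edge_boundary_def doubleton_eq_iff)
  with nj show False by (meson joined_sym joined_trans)
qed

text \<open>Turns the condition behind \<open>single_cut_count\<close> into a statement about
  connectedness after \<open>{u, v}\<close> is added, the form in which the sets can be
  counted.\<close>

lemma reconnecting_iff:
  assumes F: "F \<subseteq> edges H"
  shows "disconnected_set H F \<and> (\<forall>x\<in>verts H. joined (insert {u, v} (edges H - F)) u x) \<longleftrightarrow>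
    disconnected_set H F \<and> (\<exists>F'. F' \<subseteq> F \<and> uv_cut_set H u v F' \<and>
      (\<forall>F''. F'' \<subseteq> F \<and> uv_cut_set H u v F'' \<longrightarrow> F'' = F') \<and> \<not> disconnected_set H (F - F'))"
    (is "?L \<longleftrightarrow> _ \<and> ?R")
proof
  assume L: ?L
  have two: "joined (edges H - F) u x \<or> joined (edges H - F) v x" if "x \<in> verts H" for x
    using joined_insert_cases[of u v "edges H - F" u x] L that by blast
  \<comment> \<open>Otherwise the two components would coincide and \<open>H - F\<close> would be
    connected.\<close>
  moreover have "\<not> joined (edges H - F) u v"
    using L two unfolding disconnected_set_iff[OF simple u] by (meson joined_trans)
  ultimately show "disconnected_set H F \<and> ?R"
    using L reconnecting_imp_single_cut[OF F] by blast
next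
  assume R: "disconnected_set H F \<and> ?R"
  have two: "joined (edges H - F) u x \<or> joined (edges H - F) v x" if "x \<in> verts H" for x
    using R single_cut_imp_two_components[OF F _ _ _ _ that] by metis
  have "joined (insert {u, v} (edges H - F)) u x" if "x \<in> verts H" for x
    using two[OF that] by (meson insertI1 joined_edge joined_mono joined_trans subset_insertI)
  with R show ?L by blast
qed

end

section \<open>Counting disconnected sets, and values of the distribution function\<close>

definition disconnected_sets :: "'a sgraph \<Rightarrow> nat \<Rightarrow> 'a set set set" where
  "disconnected_sets G k = {F. F \<subseteq> edges G \<and> card F = k \<and> disconnected_set G F}"

lemma finite_disconnected_sets: "simple_graph G \<Longrightarrow> finite (disconnected_sets G k)"
  by (rule finite_subset[of _ "Pow (edges G)"])
    (auto simp: disconnected_sets_def simple_graph_finite_edges)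

text \<open>Clears the denominator, which is nonzero in this range. The convention at
  \<open>k = 0\<close> agrees with the count because deleting nothing leaves a connected graph
  connected.\<close>

lemma system_cdf_mult_choose:
  assumes "connected_graph G" "simple_graph G" "k \<le> card (edges G)"
  shows "system_cdf G k * real (card (edges G) choose k) = real (card (disconnected_sets G k))"
proof (cases "k = 0")
  case True
  have "delete_edges G {} = G" by (simp add: delete_edges_def)
  then have "F \<notin> disconnected_sets G 0" for F
    using assms finite_subset[OF _ simple_graph_finite_edges[OF assms(2)], of F]
    by (auto simp: disconnected_sets_def disconnected_set_def card_gt_0_iff)
  then have "disconnected_sets G 0 = {}" by blast
  with True show ?thesis by (simp add: system_cdf_def)
next
  case False
  with assms show ?thesis by (simp add: system_cdf_def disconnected_sets_def)
qed

text \<open>A ratio of at least 1 makes the disconnected sets as numerous as all edge sets of size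
  \<open>k\<close>, a finite family containing them, so the two families coincide.\<close>

lemma system_cdf_ge_1_imp_all_disconnected:
  assumes "simple_graph G" "system_cdf G k \<ge> 1" "F \<subseteq> edges G" "card F = k"
  shows "disconnected_set G F"
proof -
  let ?A = "{F. F \<subseteq> edges G \<and> card F = k}"
  have fin: "finite (edges G)" by (rule simple_graph_finite_edges[OF assms(1)])
  then have k: "k \<le> card (edges G)" using assms(3,4) card_mono by blast
  have "k \<noteq> 0" using assms(2) by (cases k) (auto simp: system_cdf_def)
  with k assms(2) have "card (edges G) choose k \<le> card (disconnected_sets G k)"
    by (simp add: system_cdf_def disconnected_sets_def le_divide_eq_1)
  then have "card ?A \<le> card (disconnected_sets G k)"
    using n_subsets[OF fin] by simp
  moreover have "disconnected_sets G k \<subseteq> ?A" by (auto simp: disconnected_sets_def)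
  moreover have "finite ?A" using fin by simp
  ultimately have "disconnected_sets G k = ?A" by (meson card_seteq)
  with assms(3,4) show ?thesis by (auto simp: disconnected_sets_def)
qed

lemma system_cdf_eq_1_if_all_disconnected:
  assumes "simple_graph G" "k \<noteq> 0"
    and "\<And>F. F \<subseteq> edges G \<Longrightarrow> card F = k \<Longrightarrow> disconnected_set G F"
  shows "system_cdf G k = 1"
proof (cases "k \<le> card (edges G)")
  case True
  have "{F. F \<subseteq> edges G \<and> card F = k \<and> disconnected_set G F} = {F. F \<subseteq> edges G \<and> card F = k}"
    using assms(3) by blast
  with True assms(2) show ?thesis
    using n_subsets[OF simple_graph_finite_edges[OF assms(1)]] by (simp add: system_cdf_def)
qed (use assms in \<open>simp add: system_cdf_def\<close>)

text \<open>Each set of size \<open>k\<close> contains one of size \<open>k - 1\<close>, and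
  supersets of disconnected sets are disconnected. The case \<open>k = 0\<close> is excluded because
  the distribution function vanishes at 0.\<close>

lemma system_cdf_step_1:
  assumes "simple_graph G" "u \<in> verts G" "system_cdf G (k - 1) \<ge> 1"
  shows "system_cdf G k = 1"
proof (rule system_cdf_eq_1_if_all_disconnected[OF assms(1)])
  show "k \<noteq> 0" using assms(3) by (cases k) (auto simp: system_cdf_def)
next
  fix F assume F: "F \<subseteq> edges G" "card F = k"
  then have "k - 1 \<le> card F" by simp
  then obtain F' where F': "F' \<subseteq> F" "card F' = k - 1"
    by (rule obtain_subset_with_card_n)
  have "disconnected_set G F'"
    using F(1) F' by (intro system_cdf_ge_1_imp_all_disconnected[OF assms(1,3)]) auto
  then show "disconnected_set G F"
    using F'(1) F(1) by (rule disconnected_set_mono[OF assms(1,2)])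
qed

lemma system_cdf_all_edges:
  assumes "simple_graph G" "u \<in> verts G" "v \<in> verts G" "u \<noteq> v"
    and "k \<noteq> 0" "card (edges G) \<le> k"
  shows "system_cdf G k = 1"
proof (rule system_cdf_eq_1_if_all_disconnected[OF assms(1,5)])
  fix F assume F: "F \<subseteq> edges G" "card F = k"
  then have "F = edges G"
    using assms(6) simple_graph_finite_edges[OF assms(1)] by (metis card_seteq)
  \<comment> \<open>Without edges the set \<open>{u}\<close> has empty boundary, so \<open>u\<close>
    is isolated.\<close>
  moreover have "\<not> joined {} u v"
    using joined_crosses_boundary[of "{}" u v "{u}"] assms(4) by (auto simp: edge_boundary_def)
  ultimately show "disconnected_set G F"
    using assms(3) by (auto simp: disconnected_set_iff[OF assms(1,2)])
qed

text \<open>The sum form avoids truncated subtraction on natural numbers.\<close>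

lemma card_disconnected_sets_add_edge:
  assumes "missing_edge H u v" and new: "{u, v} \<notin> edges H"
    and G: "verts G = verts H" "edges G = insert {u, v} (edges H)" "simple_graph G"
    and k: "k \<ge> 1"
  shows "card (disconnected_sets G k) + single_cut_count H u v k =
    card (disconnected_sets H k) + card (disconnected_sets H (k - 1))"
proof -
  interpret missing_edge H u v by fact
  let ?e = "{u, v}"
  \<comment> \<open>For \<open>F\<close> inside \<open>edges H\<close>, \<open>?keep F\<close> says
    that \<open>G - F\<close> is connected. Thus \<open>D2\<close> collects the
    \<open>H\<close>-disconnected sets of size \<open>k\<close> that are not
    \<open>G\<close>-disconnected.\<close>
  let ?keep = "\<lambda>F. \<forall>x\<in>verts H. joined (insert ?e (edges H - F)) u x"
  define D1 where "D1 = {F \<in> disconnected_sets H k. \<not> ?keep F}"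
  define D2 where "D2 = {F \<in> disconnected_sets H k. ?keep F}"
  have uG: "u \<in> verts G" using u G(1) by simp
  have fin: "finite (disconnected_sets H j)" for j
    using finite_disconnected_sets[OF simple] .
  have finF: "finite F" if "F \<subseteq> edges H" for F
    using that simple_graph_finite_edges[OF simple] finite_subset by blast
  have with_e: "disconnected_set G (insert ?e F) \<longleftrightarrow> disconnected_set H F"
    if "F \<subseteq> edges H" for F
  proof -
    have "edges G - insert ?e F = edges H - F" using new G(2) by auto
    with that show ?thesis
      unfolding disconnected_set_iff[OF simple u] disconnected_set_iff[OF G(3) uG]
      using G(1,2) by auto
  qed
  have without_e: "disconnected_set G F \<longleftrightarrow> disconnected_set H F \<and> \<not> ?keep F"
    if "F \<subseteq> edges H" for F
  proof -
    have "edges G - F = insert ?e (edges H - F)" using new that G(2) by auto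
    moreover have "joined (edges H - F) u x \<Longrightarrow> joined (insert ?e (edges H - F)) u x" for x
      by (erule joined_mono) blast
    ultimately show ?thesis
      using that unfolding disconnected_set_iff[OF simple u] disconnected_set_iff[OF G(3) uG]
      using G(1,2) by auto
  qed
  have split: "disconnected_sets G k = insert ?e ` disconnected_sets H (k - 1) \<union> D1"
  proof (intro set_eqI iffI)
    fix F assume F: "F \<in> disconnected_sets G k"
    show "F \<in> insert ?e ` disconnected_sets H (k - 1) \<union> D1"
    proof (cases "?e \<in> F")
      case True
      have sub: "F - {?e} \<subseteq> edges H" and ins: "insert ?e (F - {?e}) = F"
        using F True G(2) by (auto simp: disconnected_sets_def)
      have "F - {?e} \<in> disconnected_sets H (k - 1)"
        using F sub with_e[OF sub] ins True by (auto simp: disconnected_sets_def)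
      with ins show ?thesis by (metis UnI1 imageI)
    next
      case False
      then have "F \<subseteq> edges H" using F G(2) by (auto simp: disconnected_sets_def)
      with F without_e show ?thesis by (auto simp: disconnected_sets_def D1_def)
    qed
  next
    fix F assume "F \<in> insert ?e ` disconnected_sets H (k - 1) \<union> D1"
    then show "F \<in> disconnected_sets G k"
    proof
      assume "F \<in> insert ?e ` disconnected_sets H (k - 1)"
      then obtain F' where F': "F = insert ?e F'" "F' \<in> disconnected_sets H (k - 1)"
        by blast
      then have "F' \<subseteq> edges H" "?e \<notin> F'" "card F' = k - 1" "disconnected_set H F'"
        using new unfolding disconnected_sets_def by blast+
      \<comment> \<open>The new edge raises the size from \<open>k - 1\<close> to \<open>k\<close>,
        which relies on \<open>k \<ge> 1\<close>.\<close>
      with F'(1) with_e[of F'] finF[of F'] k G(2) show ?thesis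
        by (auto simp: disconnected_sets_def)
    next
      assume "F \<in> D1"
      with without_e[of F] G(2) show ?thesis by (auto simp: disconnected_sets_def D1_def)
    qed
  qed
  have inj: "inj_on (insert ?e) (disconnected_sets H (k - 1))"
  proof (rule inj_onI)
    fix F F' assume F: "F \<in> disconnected_sets H (k - 1)" "F' \<in> disconnected_sets H (k - 1)"
      and eq: "insert ?e F = insert ?e F'"
    have "?e \<notin> F" "?e \<notin> F'" using F new unfolding disconnected_sets_def by blast+
    with eq show "F = F'" by (simp add: insert_ident)
  qed
  have "insert ?e ` disconnected_sets H (k - 1) \<inter> D1 = {}"
    using new by (auto simp: D1_def disconnected_sets_def)
  moreover have "finite D1" using fin by (simp add: D1_def)
  ultimately have "card (disconnected_sets G k) = card (disconnected_sets H (k - 1)) + card D1"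
    unfolding split using fin card_image[OF inj] by (simp add: card_Un_disjoint)
  moreover have "card (disconnected_sets H k) = card D1 + card D2"
  proof -
    have "disconnected_sets H k = D1 \<union> D2" "D1 \<inter> D2 = {}" by (auto simp: D1_def D2_def)
    then show ?thesis using fin[of k] by (metis card_Un_disjoint finite_Un)
  qed
  \<comment> \<open>\<open>reconnecting_iff\<close> applies to subsets of \<open>edges H\<close>;
    any other \<open>F\<close> belongs to neither family.\<close>
  moreover have "single_cut_count H u v k = card D2"
  proof -
    have "D2 = {F. disconnected_set H F \<and> card F = k \<and>
      (\<exists>F'. F' \<subseteq> F \<and> uv_cut_set H u v F' \<and>
        (\<forall>F''. F'' \<subseteq> F \<and> uv_cut_set H u v F'' \<longrightarrow> F'' = F') \<and> \<not> disconnected_set H (F - F'))}"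
    proof (intro set_eqI)
      fix F
      show "F \<in> D2 \<longleftrightarrow> F \<in> {F. disconnected_set H F \<and> card F = k \<and>
        (\<exists>F'. F' \<subseteq> F \<and> uv_cut_set H u v F' \<and>
        (\<forall>F''. F'' \<subseteq> F \<and> uv_cut_set H u v F'' \<longrightarrow> F'' = F') \<and> \<not> disconnected_set H (F - F'))}"
      proof (cases "F \<subseteq> edges H")
        case True
        then show ?thesis
          using reconnecting_iff[OF True] unfolding D2_def disconnected_sets_def by blast
      next
        case False
        then show ?thesis by (auto simp: D2_def disconnected_sets_def disconnected_set_def)
      qed
    qed
    then show ?thesis by (simp add: single_cut_count_def)
  qed
  ultimately show ?thesis by simp
qed

theorem theorem4p4:
  fixes M N k :: nat and H G :: "'a sgraph" and u v :: 'a
  assumes "M \<ge> 2" and "N \<ge> 1"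
    and "simple_graph H" and "connected_graph H"
    and "card (verts H) = N" and "card (edges H) = M - 1"
    and "u \<in> verts H" and "v \<in> verts H" and "u \<noteq> v" and "{u, v} \<notin> edges H"
    and "verts G = verts H" and "edges G = edges H \<union> {{u, v}}"
    and "k \<ge> 1"
  shows "system_cdf G k =
    (if 1 \<le> k \<and> k \<le> M - 1 \<and> system_cdf G (k - 1) < 1
     then (system_cdf H k * real ((M - 1) choose k)
           + system_cdf H (k - 1) * real ((M - 1) choose (k - 1))
           - real (single_cut_count H u v k)) / real (M choose k)
     else 1)"
proof -
  have G: "simple_graph G"
    using assms by (auto simp: simple_graph_def)
  have cardG: "card (edges G) = M"
    using assms simple_graph_finite_edges[OF assms(3)] by simp
  have mis: "missing_edge H u v"
    using assms by unfold_locales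
  \<comment> \<open>The last two cases, which may overlap, are the two ways in which the condition
    of the formula fails.\<close>
  consider "k \<le> M - 1" "system_cdf G (k - 1) < 1" | "system_cdf G (k - 1) \<ge> 1" | "k \<ge> M"
    by linarith
  then show ?thesis
  proof cases
    case 1
    have "real (card (disconnected_sets G k)) + real (single_cut_count H u v k) =
        real (card (disconnected_sets H k)) + real (card (disconnected_sets H (k - 1)))"
      using card_disconnected_sets_add_edge[OF mis assms(10,11) _ G assms(13)] assms(12)
      by (simp flip: of_nat_add)
    moreover have "system_cdf G k = real (card (disconnected_sets G k)) / real (M choose k)"
      using 1 assms(13) cardG by (simp add: system_cdf_def disconnected_sets_def)
    \<comment> \<open>Both products with binomials become counts for \<open>H\<close>, including the
      product at \<open>k - 1 = 0\<close>.\<close>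
    ultimately show ?thesis
      using 1 assms(13) system_cdf_mult_choose[OF assms(4,3), of k]
        system_cdf_mult_choose[OF assms(4,3), of "k - 1"] assms(6)
      by (simp add: field_simps)
  next
    case 2
    then show ?thesis
      using system_cdf_step_1[OF G, of u k] assms(7,11) by simp
  next
    case 3
    then show ?thesis
      using system_cdf_all_edges[OF G, of u v k] assms cardG by auto
  qed
qed

end
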